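(* Let $\mathcal{X}\subset\mathbb{R}^n$ be a convex set, $N\ge1$, and for each $k\ge1$ let $h_k=f_k+g_k$ where $f_k=\frac1N\sum_{i=1}^N f_k^i$ with each $f_k^i:\mathcal{X}\to\mathbb{R}$ differentiable, and $g_k:\mathcal{X}\to\mathbb{R}$ convex; let $\mathbf{x}_k^\star=\arg\min_{\mathbf{x}\in\mathcal{X}}h_k(\mathbf{x})$. Let $L,\mu,M>0$ be such that for all $i,k$ and all $\mathbf{x},\mathbf{y}\in\mathcal{X}$: $\|\nabla f_k^i(\mathbf{x})-\nabla f_k^i(\mathbf{y})\|\le L\|\mathbf{x}-\mathbf{y}\|$; $\langle\nabla f_k^i(\mathbf{x})-\nabla f_k^i(\mathbf{y}),\mathbf{x}-\mathbf{y}\rangle\ge\mu\|\mathbf{x}-\mathbf{y}\|^2$; and $\max_{i,k}\|\nabla f_k^i(\mathbf{x}_k)\|\le M$ along the iterates $\mathbf{x}_k$ of the online proximal-SVRG (OP-SVRG) algorithm. Let the refresh period $K_0\ge1$ be a fixed integer. If $\mu/L>0.89$, then there exists a step size $0<\alpha<2\mu/L^2$ such that the gradient errors $\mathbf{e}_k$ of OP-SVRG run with step size $\alpha$ satisfy $$E_K:=\sum_{k=1}^K\mathbb{E}\|\mathbf{e}_k\|=\mathcal{O}\Big(1+W_K+\sum_{j=1}^N\sqrt{K V_K^j}\Big),$$ i.e. there is a constant $C$ independent of $K$ with $E_K\le C\big(1+W_K+\sum_{j=1}^N\sqrt{KV_K^j}\big)$ for all $K\ge1$, where $W_K=\sum_{k=2}^K\|\mathbf{x}_k^\star-\mathbf{x}_{k-1}^\star\|$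 and $V_K^j=\sum_{k=2}^K\max_{\mathbf{x}\in\mathcal{X}}\|\nabla f_k^j(\mathbf{x})-\nabla f_{k-1}^j(\mathbf{x})\|^2$.
   Context: $\|\cdot\|$ is the Euclidean norm. The functions and the initial point $\mathbf{x}_1$ are deterministic; the minimizers $\mathbf{x}_k^\star$ and those defining the proximal operator are assumed to exist. OP-SVRG algorithm: initialize $\mathbf{x}_1\in\mathcal{X}$. At each time $k=1,2,\dots$: if $k$ is the first iteration of a block of $K_0$ consecutive iterations (i.e. $k\equiv1 \pmod{K_0}$), set $\tilde{\mathbf{x}}\leftarrow\mathbf{x}_k$ and $\mathbf{m}\leftarrow\frac1N\sum_{j=1}^N\nabla f_k^j(\tilde{\mathbf{x}})$; then select an index $i\in\{1,\dots,N\}$, either uniformly at random (independently across iterations) or cyclically; form $$\tilde\nabla f_k(\mathbf{x}_k)=\nabla f_k^i(\mathbf{x}_k)-\nabla f_k^i(\tilde{\mathbf{x}})+\mathbf{m},$$ and update $\mathbf{x}_{k+1}=\mathrm{prox}_{g_k}^\alpha\big(\mathbf{x}_k-\alpha\tilde\nabla f_k(\mathbf{x}_k)\big)$, where $\mathrm{prox}_{g_k}^{\alpha}(\mathbf{x})=\arg\min_{\mathbf{u}\in\mathcal{X}} g_k(\mathbf{u})+\frac{1}{2\alpha}\|\mathbf{u}-\mathbf{x}\|^2$. Thus at time $k$, $\tilde{\mathbf{x}}=\mathbf{x}_{\tau_k}$ and $\mathbf{m}=\frac1N\sum_j\nabla f_{\tau_k}^j(\mathbf{x}_{\tau_k})$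 with $\tau_k=\lfloor (k-1)/K_0\rfloor K_0+1$. The gradient error is $\mathbf{e}_k=\tilde\nabla f_k(\mathbf{x}_k)-\nabla f_k(\mathbf{x}_k)$. Expectation is over the random index selections. *)

theory Defs
  imports "HOL-Analysis.Analysis" "HOL-Probability.Probability"
begin

text \<open>
  The dimension is that of an arbitrary Euclidean space. Times and component indices are
  natural numbers counted from 1: \<open>f k i\<close> is the \<open>i\<close>-th component function at time \<open>k\<close>
  and \<open>G k i\<close> its gradient field.
\<close>

text \<open>
  Differentiability is taken within \<open>X\<close>, since the functions only live on \<open>X\<close>. At points where
  the gradient within \<open>X\<close> is not unique (\<open>X\<close> of lower dimension), \<open>G\<close> is any choice of it.
\<close>

definition has_gradient_on ::
  "('a::euclidean_space \<Rightarrow> real) \<Rightarrow> ('a \<Rightarrow> 'a) \<Rightarrow> 'a set \<Rightarrow> bool" where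
  "has_gradient_on f G X \<longleftrightarrow>
     (\<forall>x\<in>X. (f has_derivative (\<lambda>h. G x \<bullet> h)) (at x within X))"

definition average :: "nat \<Rightarrow> (nat \<Rightarrow> 'a \<Rightarrow> 'b::real_vector) \<Rightarrow> 'a \<Rightarrow> 'b" where
  "average N F x = (1 / real N) *\<^sub>R (\<Sum>i=1..N. F i x)"

definition prox_objective ::
  "real \<Rightarrow> ('a::euclidean_space \<Rightarrow> real) \<Rightarrow> 'a \<Rightarrow> 'a \<Rightarrow> real" where
  "prox_objective \<alpha> g x u = g u + 1 / (2 * \<alpha>) * (norm (u - x))\<^sup>2"

definition prox ::
  "'a::euclidean_space set \<Rightarrow> real \<Rightarrow> ('a \<Rightarrow> real) \<Rightarrow> 'a \<Rightarrow> 'a" where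
  "prox X \<alpha> g x = arg_min_on (prox_objective \<alpha> g x) X"

definition refresh_time :: "nat \<Rightarrow> nat \<Rightarrow> nat" where
  "refresh_time K0 k = (k - 1) div K0 * K0 + 1"

definition svrg_gradient ::
  "nat \<Rightarrow> nat \<Rightarrow> (nat \<Rightarrow> nat \<Rightarrow> 'a \<Rightarrow> 'a) \<Rightarrow> (nat \<Rightarrow> nat) \<Rightarrow>
   (nat \<Rightarrow> 'a::euclidean_space) \<Rightarrow> nat \<Rightarrow> 'a" where
  "svrg_gradient N K0 G i x k =
     (let \<tau> = refresh_time K0 k in
        G k (i k) (x k) - G k (i k) (x \<tau>) + average N (G \<tau>) (x \<tau>))"

text \<open>
  \<open>x\<close> is the trajectory produced along the index sequence \<open>i\<close>. The conditions determine
  \<open>x k\<close> for all \<open>k \<ge> 1\<close>; the value \<open>x 0\<close> is irrelevant.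
\<close>

definition op_svrg ::
  "'a::euclidean_space set \<Rightarrow> nat \<Rightarrow> nat \<Rightarrow> (nat \<Rightarrow> nat \<Rightarrow> 'a \<Rightarrow> 'a) \<Rightarrow>
   (nat \<Rightarrow> 'a \<Rightarrow> real) \<Rightarrow> 'a \<Rightarrow> real \<Rightarrow> (nat \<Rightarrow> nat) \<Rightarrow> (nat \<Rightarrow> 'a) \<Rightarrow> bool" where
  "op_svrg X N K0 G g x1 \<alpha> i x \<longleftrightarrow>
     x 1 = x1 \<and>
     (\<forall>k\<ge>1. x (k + 1) = prox X \<alpha> (g k) (x k - \<alpha> *\<^sub>R svrg_gradient N K0 G i x k))"

text \<open>The gradient of the average \<open>f k\<close> is the average of the component gradients.\<close>

definition gradient_error ::
  "nat \<Rightarrow> nat \<Rightarrow> (nat \<Rightarrow> nat \<Rightarrow> 'a \<Rightarrow> 'a) \<Rightarrow> (nat \<Rightarrow> nat) \<Rightarrow>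
   (nat \<Rightarrow> 'a::euclidean_space) \<Rightarrow> nat \<Rightarrow> 'a" where
  "gradient_error N K0 G i x k = svrg_gradient N K0 G i x k - average N (G k) (x k)"

definition uniform_selection :: "'w measure \<Rightarrow> nat \<Rightarrow> (nat \<Rightarrow> 'w \<Rightarrow> nat) \<Rightarrow> bool" where
  "uniform_selection P N \<iota> \<longleftrightarrow>
     (\<forall>k\<ge>1. \<forall>\<omega>\<in>space P. \<iota> k \<omega> \<in> {1..N}) \<and>
     prob_space.indep_vars P (\<lambda>_. count_space UNIV) \<iota> {1..} \<and>
     (\<forall>k\<ge>1. distr P (count_space UNIV) (\<iota> k) = measure_pmf (pmf_of_set {1..N}))"

text \<open>The cycle may start at any index, given by the offset \<open>c\<close>.\<close>

definition cyclic_selection :: "'w measure \<Rightarrow> nat \<Rightarrow> (nat \<Rightarrow> 'w \<Rightarrow> nat) \<Rightarrow> bool" where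
  "cyclic_selection P N \<iota> \<longleftrightarrow>
     (\<exists>c. \<forall>k\<ge>1. \<forall>\<omega>\<in>space P. \<iota> k \<omega> = (k - 1 + c) mod N + 1)"

definition cumulative_error ::
  "'w measure \<Rightarrow> nat \<Rightarrow> nat \<Rightarrow> (nat \<Rightarrow> nat \<Rightarrow> 'a \<Rightarrow> 'a) \<Rightarrow> (nat \<Rightarrow> 'w \<Rightarrow> nat) \<Rightarrow>
   ('w \<Rightarrow> nat \<Rightarrow> 'a::euclidean_space) \<Rightarrow> nat \<Rightarrow> real" where
  "cumulative_error P N K0 G \<iota> x K =
     (\<Sum>k=1..K. (\<integral>\<omega>. norm (gradient_error N K0 G (\<lambda>t. \<iota> t \<omega>) (x \<omega>) k) \<partial>P))"

definition path_length :: "(nat \<Rightarrow> 'a::euclidean_space) \<Rightarrow> nat \<Rightarrow> real" where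
  "path_length xs K = (\<Sum>k=2..K. norm (xs k - xs (k - 1)))"

text \<open>
  The maximum over \<open>X\<close> is rendered as a supremum; it is only meaningful when the set of values
  is bounded above, which users of this definition have to assume.
\<close>

definition gradient_variation ::
  "'a::euclidean_space set \<Rightarrow> (nat \<Rightarrow> nat \<Rightarrow> 'a \<Rightarrow> 'a) \<Rightarrow> nat \<Rightarrow> nat \<Rightarrow> real" where
  "gradient_variation X G j K =
     (\<Sum>k=2..K. (SUP x\<in>X. (norm (G k j x - G (k - 1) j x))\<^sup>2))"

end

theory Submission
  imports Defs
begin

text \<open>
  The bound holds along every trajectory once the step size is small compared with \<open>(1 / 4) ^ K0\<close>.
  Write \<open>a\<close> for the distance of the iterate to the current minimizer, \<open>q\<close> for its distance to the
  last refresh point and \<open>d\<close> for the length of the next move; a prime marks the next time. The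
  gradient error is at most \<open>2 * L * q\<close> plus the drift of the gradients since the refresh. The
  variational inequalities of the proximal step and of the minimizer give
  \<open>a'\<^sup>2 + d\<^sup>2 / 2 \<le> (1 - \<alpha> * \<mu>) * a\<^sup>2 + 2 * \<alpha> * error * a'\<close>: a long move is paid for by
  progress towards the minimizer. Hence \<open>sqrt (a\<^sup>2 + r * q\<^sup>2)\<close>, with a weight \<open>r\<close> that drops by
  the factor 4 at each step inside a block, contracts by a fixed factor up to the drift. It is
  Lipschitz in the minimizer, so summation yields the path length and, by Cauchy-Schwarz, the
  square roots of the gradient variation.
\<close>

section \<open>Componentwise bounds passed on to averages\<close>

lemma average_diff_norm_le:
  fixes F H :: "nat \<Rightarrow> 'a \<Rightarrow> 'b::real_normed_vector"
  assumes "N \<ge> 1" and "\<And>i. i \<in> {1..N} \<Longrightarrow> norm (F i y - H i z) \<le> c"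
  shows "norm (average N F y - average N H z) \<le> c"
proof -
  have "average N F y - average N H z = (1 / real N) *\<^sub>R (\<Sum>i=1..N. F i y - H i z)"
    by (simp add: average_def sum_subtractf scaleR_diff_right)
  moreover have "norm (\<Sum>i=1..N. F i y - H i z) \<le> (\<Sum>i=1..N. c)"
    using assms(2) by (rule sum_norm_le)
  ultimately show ?thesis
    using assms(1) by (simp add: field_simps)
qed

lemma average_diff_inner_ge:
  fixes F :: "nat \<Rightarrow> 'a \<Rightarrow> 'a::euclidean_space"
  assumes "N \<ge> 1" and "\<And>i. i \<in> {1..N} \<Longrightarrow> c \<le> (F i y - F i z) \<bullet> w"
  shows "c \<le> (average N F y - average N F z) \<bullet> w"
proof -
  have "(average N F y - average N F z) \<bullet> w = (\<Sum>i=1..N. (F i y - F i z) \<bullet> w) / real N"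
    by (simp add: average_def inner_sum_left sum_subtractf inner_diff_left diff_divide_distrib)
  moreover have "(\<Sum>i=1..N. c) \<le> (\<Sum>i=1..N. (F i y - F i z) \<bullet> w)"
    using assms(2) by (rule sum_mono)
  ultimately show ?thesis
    using assms(1) by (simp add: le_divide_eq mult.commute)
qed

lemma average_has_derivative:
  assumes "\<And>i. i \<in> {1..N} \<Longrightarrow> has_gradient_on (f i) (G i) X" and "y \<in> X"
  shows "(average N f has_derivative (\<lambda>h. average N G y \<bullet> h)) (at y within X)"
proof -
  have "((\<lambda>y. (1 / real N) *\<^sub>R (\<Sum>i=1..N. f i y)) has_derivative
      (\<lambda>h. (1 / real N) *\<^sub>R (\<Sum>i=1..N. G i y \<bullet> h))) (at y within X)"
    using assms by (intro derivative_intros) (auto simp: has_gradient_on_def)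
  then show ?thesis
    by (simp add: average_def[abs_def] inner_sum_left)
qed

section \<open>Variational inequalities for minimizers and the inexact proximal step\<close>

text \<open>Along the segment from \<open>p\<close> to \<open>u\<close>, minimality of
  \<open>p\<close> and convexity of \<open>g\<close> bound the difference quotient of
  \<open>F\<close> from below by \<open>g p - g u\<close>; the limit at 0 gives the claim. Thus
  \<open>F\<close> may be nonconvex and \<open>g\<close> nonsmooth.\<close>

lemma composite_minimizer_inequality:
  fixes F g :: "'a::euclidean_space \<Rightarrow> real"
  assumes X: "convex X" and g: "convex_on X g"
    and min: "is_arg_min (\<lambda>y. F y + g y) (\<lambda>y. y \<in> X) p"
    and F: "(F has_derivative (\<lambda>h. v \<bullet> h)) (at p within X)"
    and u: "u \<in> X"
  shows "g p - g u \<le> v \<bullet> (u - p)"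
proof -
  have p: "p \<in> X" and le: "\<And>y. y \<in> X \<Longrightarrow> F p + g p \<le> F y + g y"
    using min by (auto simp: is_arg_min_def not_less)
  define c where "c t = (1 - t) *\<^sub>R p + t *\<^sub>R u" for t :: real
  have c0: "c 0 = p" by (simp add: c_def)
  have cX: "c t \<in> X" if "t \<in> {0..1}" for t
    using X p u that unfolding c_def by (intro convexD) auto
  have "(c has_derivative (\<lambda>t. t *\<^sub>R (u - p))) (at 0 within {0..1})"
    unfolding c_def by (auto intro!: derivative_eq_intros simp: algebra_simps)
  moreover have "(F has_derivative (\<lambda>h. v \<bullet> h)) (at (c 0) within c ` {0..1})"
    unfolding c0 by (rule has_derivative_subset[OF F]) (use cX in auto)
  ultimately have "((\<lambda>t. F (c t)) has_derivative (\<lambda>t. v \<bullet> (t *\<^sub>R (u - p)))) (at 0 within {0..1})"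
    using diff_chain_within[of c "\<lambda>t. t *\<^sub>R (u - p)" 0 "{0..1}" F "\<lambda>h. v \<bullet> h"] by (simp add: o_def)
  moreover have "(\<lambda>t. v \<bullet> (t *\<^sub>R (u - p))) = (*) (v \<bullet> (u - p))"
    by (auto simp: mult.commute)
  ultimately have "((\<lambda>t. F (c t)) has_real_derivative v \<bullet> (u - p)) (at 0 within {0..1})"
    by (simp only: has_field_derivative_def)
  then have lim: "((\<lambda>t. (F (c t) - F p) / t) \<longlongrightarrow> v \<bullet> (u - p)) (at 0 within {0..1})"
    by (simp add: has_field_derivative_iff c0)
  have "g p - g u \<le> (F (c t) - F p) / t" if "t \<in> {0..1}" "t \<noteq> 0" for t
  proof -
    have "g (c t) \<le> (1 - t) * g p + t * g u"
      using convex_onD[OF g, of t p u] that p u by (simp add: c_def)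
    moreover have "F p + g p \<le> F (c t) + g (c t)" by (rule le[OF cX]) (use that in auto)
    ultimately have "t * (g p - g u) \<le> F (c t) - F p" by (simp add: algebra_simps)
    then show ?thesis using that by (simp add: field_simps)
  qed
  then have "eventually (\<lambda>t. g p - g u \<le> (F (c t) - F p) / t) (at 0 within {0..1})"
    by (auto simp: eventually_at_filter)
  moreover have "at 0 within {0..1::real} \<noteq> bot"
    by (simp add: trivial_limit_within islimpt_Icc)
  ultimately show ?thesis using tendsto_lowerbound[OF lim] by blast
qed

lemma prox_arg_min:
  assumes "\<exists>u. is_arg_min (prox_objective \<alpha> g y) (\<lambda>u. u \<in> X) u"
  shows "is_arg_min (prox_objective \<alpha> g y) (\<lambda>u. u \<in> X) (prox X \<alpha> g y)"
  using someI_ex[OF assms] by (simp add: prox_def arg_min_on_def arg_min_def)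

text \<open>First-order condition for the quadratic penalty as smooth part; its gradient at
  \<open>p\<close> is \<open>p - y\<close> scaled by \<open>1 / \<alpha>\<close>, and the factor
  \<open>\<alpha>\<close> clears the denominator.\<close>

lemma prox_inequality:
  fixes g :: "'a::euclidean_space \<Rightarrow> real"
  assumes "convex X" and "convex_on X g" and "\<alpha> > 0"
    and ex: "\<exists>u. is_arg_min (prox_objective \<alpha> g y) (\<lambda>u. u \<in> X) u"
    and p: "p = prox X \<alpha> g y" and "u \<in> X"
  shows "\<alpha> * (g p - g u) \<le> (p - y) \<bullet> (u - p)"
proof -
  have derivative: "((\<lambda>u. 1 / (2 * \<alpha>) * ((u - y) \<bullet> (u - y))) has_derivative (\<lambda>h. ((1 / \<alpha>) *\<^sub>R (p - y)) \<bullet> h))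
      (at p within X)"
    using \<open>\<alpha> > 0\<close>
    by (auto intro!: derivative_eq_intros simp: inner_commute field_simps inner_simps)
  have "is_arg_min (\<lambda>u. 1 / (2 * \<alpha>) * ((u - y) \<bullet> (u - y)) + g u) (\<lambda>u. u \<in> X) p"
    using prox_arg_min[OF ex]
    by (simp add: p prox_objective_def[abs_def] power2_norm_eq_inner add.commute)
  then have "g p - g u \<le> ((1 / \<alpha>) *\<^sub>R (p - y)) \<bullet> (u - p)"
    using derivative \<open>u \<in> X\<close> by (rule composite_minimizer_inequality[OF assms(1,2)])
  then show ?thesis using \<open>\<alpha> > 0\<close> by (simp add: pos_divide_le_eq pos_le_divide_eq mult.commute)
qed

text \<open>In use, \<open>v\<close> and \<open>w\<close> are the gradients of the smooth part at
  the iterate \<open>x\<close> and the minimizer \<open>s\<close>, and \<open>e\<close> is the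
  gradient error. The gradient is taken at \<open>x\<close> and not at the new point
  \<open>p\<close>; half of the squared move and half of the gain
  \<open>2 * \<alpha> * \<mu>\<close> from strong monotonicity pay for this.\<close>

lemma inexact_prox_step:
  fixes p x s v w e :: "'a::euclidean_space"
  assumes prox: "\<alpha> * (gp - gs) \<le> (p - (x - \<alpha> *\<^sub>R (v + e))) \<bullet> (s - p)"
    and opt: "gs - gp \<le> w \<bullet> (p - s)"
    and mono: "\<mu> * (norm (x - s))\<^sup>2 \<le> (v - w) \<bullet> (x - s)"
    and lip: "norm (v - w) \<le> L * norm (x - s)"
    and \<alpha>: "0 < \<alpha>" "2 * \<alpha> * L\<^sup>2 \<le> \<mu>"
  shows "(norm (p - s))\<^sup>2 + (norm (p - x))\<^sup>2 / 2
    \<le> (1 - \<alpha> * \<mu>) * (norm (x - s))\<^sup>2 + 2 * \<alpha> * norm e * norm (p - s)"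
proof -
  \<comment> \<open>Adding the two variational inequalities cancels \<open>gp\<close> and
    \<open>gs\<close>; expanding the inner products then yields the squared distances.\<close>
  have "0 \<le> (p - (x - \<alpha> *\<^sub>R (v + e))) \<bullet> (s - p) + \<alpha> * (w \<bullet> (p - s))"
    using prox mult_left_mono[OF opt, of \<alpha>] \<alpha>(1) by (simp add: algebra_simps)
  then have "(norm (p - s))\<^sup>2 + (norm (p - x))\<^sup>2
      \<le> (norm (x - s))\<^sup>2 - 2 * \<alpha> * ((v - w) \<bullet> (x - s)) - 2 * \<alpha> * ((v - w) \<bullet> (p - x))
        - 2 * \<alpha> * (e \<bullet> (p - s))"
    unfolding power2_norm_eq_inner by (simp add: algebra_simps inner_commute)
  moreover have "2 * \<alpha> * (\<mu> * (norm (x - s))\<^sup>2) \<le> 2 * \<alpha> * ((v - w) \<bullet> (x - s))"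
    using mono \<alpha> by simp
  moreover have "2 * \<alpha> * (- ((v - w) \<bullet> (p - x))) \<le> 2 * \<alpha> * (L * norm (x - s) * norm (p - x))"
  proof -
    have "- ((v - w) \<bullet> (p - x)) \<le> norm (v - w) * norm (p - x)"
      using Cauchy_Schwarz_ineq2[of "v - w" "p - x"] by linarith
    also have "\<dots> \<le> L * norm (x - s) * norm (p - x)"
      using lip by (rule mult_right_mono) simp
    finally show ?thesis using \<alpha>(1) by (intro mult_left_mono) auto
  qed
  \<comment> \<open>Young's inequality, balanced to use up exactly half of the squared move.\<close>
  moreover have "2 * \<alpha> * (L * norm (x - s) * norm (p - x))
      \<le> (norm (p - x))\<^sup>2 / 2 + 2 * (\<alpha> * L * norm (x - s))\<^sup>2"
    using zero_le_power2[of "norm (p - x) - 2 * (\<alpha> * L * norm (x - s))"]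
    by (simp add: power2_eq_square algebra_simps)
  moreover have "2 * (\<alpha> * L * norm (x - s))\<^sup>2 \<le> \<alpha> * \<mu> * (norm (x - s))\<^sup>2"
    using mult_right_mono[OF mult_left_mono[OF \<alpha>(2), of \<alpha>], of "(norm (x - s))\<^sup>2"] \<alpha>(1)
    by (simp add: power_mult_distrib power2_eq_square algebra_simps)
  moreover have "2 * \<alpha> * (- (e \<bullet> (p - s))) \<le> 2 * \<alpha> * (norm e * norm (p - s))"
    using Cauchy_Schwarz_ineq2[of e "p - s"] \<alpha>(1) by (intro mult_left_mono) auto
  ultimately show ?thesis
    unfolding mult.assoc left_diff_distrib mult_minus_right mult_1 by linarith
qed

section \<open>Contraction of the potential in scalar form\<close>

text \<open>Because \<open>1 - c \<le> (1 - c / 2)\<^sup>2\<close>, a \<open>y\<close> above the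
  bound would make the right side of the hypothesis at most \<open>(z + b) * y\<close>, hence less
  than \<open>y\<^sup>2\<close>. The contradiction avoids dividing by \<open>y\<close>.\<close>

lemma le_of_square_le:
  fixes y a b c :: real
  assumes "y\<^sup>2 \<le> (1 - c) * a\<^sup>2 + b * y" and "0 \<le> y" "0 \<le> a" "0 \<le> b" "0 \<le> c" "c \<le> 1"
  shows "y \<le> (1 - c / 2) * a + b"
proof (rule ccontr)
  define z where "z = (1 - c / 2) * a"
  assume "\<not> ?thesis"
  then have y: "z + b < y" by (simp add: z_def)
  have "0 \<le> z" unfolding z_def using assms by (intro mult_nonneg_nonneg) auto
  have "(1 - c) * a\<^sup>2 \<le> z\<^sup>2"
  proof -
    have "(1 - c) * a\<^sup>2 \<le> (1 - c / 2)\<^sup>2 * a\<^sup>2"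
      by (rule mult_right_mono) (auto simp: power2_eq_square algebra_simps)
    then show ?thesis by (simp add: z_def power_mult_distrib)
  qed
  also have "z\<^sup>2 \<le> z * y"
    using y \<open>0 \<le> z\<close> assms by (auto simp: power2_eq_square intro!: mult_left_mono)
  finally have "(1 - c) * a\<^sup>2 + b * y \<le> (z + b) * y" by (simp add: algebra_simps)
  also have "\<dots> < y * y" using y \<open>0 \<le> z\<close> assms by (intro mult_strict_right_mono) auto
  finally show False using assms(1) by (simp add: power2_eq_square)
qed

text \<open>Young's inequality splits the product of \<open>q\<close> and \<open>a'\<close>. The
  loss is covered by half of the gain \<open>\<alpha> * \<mu>\<close> and by the half of
  \<open>r\<close> that \<open>weight\<close> leaves over.\<close>

lemma potential_contraction:
  fixes a a' d q q' r r' D L \<alpha> \<mu> :: real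
  assumes step: "a'\<^sup>2 + d\<^sup>2 / 2 \<le> (1 - \<alpha> * \<mu>) * a\<^sup>2 + 2 * \<alpha> * (2 * L * q + D) * a'"
    and weight: "r' * q'\<^sup>2 \<le> d\<^sup>2 / 2 + r / 2 * q\<^sup>2"
    and small: "32 * \<alpha> * L\<^sup>2 \<le> r * \<mu>" "4 * (\<alpha> * \<mu>) \<le> 1"
    and pos: "0 < \<alpha>" "0 < \<mu>" "0 < r" "0 \<le> r'" "0 \<le> D" "0 \<le> a'"
  shows "sqrt (a'\<^sup>2 + r' * q'\<^sup>2) \<le> (1 - \<alpha> * \<mu> / 4) * sqrt (a\<^sup>2 + r * q\<^sup>2) + 4 * \<alpha> * D"
proof -
  define y where "y = sqrt (a'\<^sup>2 + r' * q'\<^sup>2)"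
  define \<Phi> where "\<Phi> = sqrt (a\<^sup>2 + r * q\<^sup>2)"
  define h where "h = \<alpha> * \<mu> / 2"
  have y2: "y\<^sup>2 = a'\<^sup>2 + r' * q'\<^sup>2" and \<Phi>2: "\<Phi>\<^sup>2 = a\<^sup>2 + r * q\<^sup>2"
    using pos by (auto simp: y_def \<Phi>_def intro!: real_sqrt_pow2)
  have nn: "0 \<le> y" "0 \<le> \<Phi>" using pos by (auto simp: y_def \<Phi>_def)
  have ay: "a' \<le> y" unfolding y_def using pos by (intro real_le_rsqrt) auto
  have h: "0 < h" "8 * h \<le> 1" "\<alpha> * \<mu> = 2 * h" using pos small by (auto simp: h_def)
  have cross: "4 * \<alpha> * L * q * a' \<le> h * a'\<^sup>2 + r / 4 * q\<^sup>2"
  proof -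
    have "4 * \<alpha> * L * q * a' \<le> \<alpha> / 2 * (\<mu> * a'\<^sup>2) + 8 * \<alpha> * L\<^sup>2 / \<mu> * q\<^sup>2"
    proof -
      have "0 \<le> \<alpha> / (2 * \<mu>) * (\<mu> * a' - 4 * L * q)\<^sup>2" using pos by simp
      also have "\<dots> = \<alpha> / 2 * (\<mu> * a'\<^sup>2) + 8 * \<alpha> * L\<^sup>2 / \<mu> * q\<^sup>2 - 4 * \<alpha> * L * q * a'"
        using pos by (simp add: field_simps power2_eq_square)
      finally show ?thesis by simp
    qed
    moreover have "8 * \<alpha> * L\<^sup>2 / \<mu> * q\<^sup>2 \<le> r / 4 * q\<^sup>2"
      using small pos by (intro mult_right_mono) (auto simp: field_simps)
    ultimately show ?thesis by (simp add: h_def)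
  qed
  \<comment> \<open>The coefficient \<open>3 / 4\<close> is \<open>1 / 2\<close> from
    \<open>weight\<close> plus \<open>1 / 4\<close> from \<open>cross\<close>; it stays below
    \<open>1 - 2 * h\<close> since \<open>8 * h \<le> 1\<close>.\<close>
  have "y\<^sup>2 \<le> (1 - 2 * h) * a\<^sup>2 + 3 / 4 * r * q\<^sup>2 + h * a'\<^sup>2 + 2 * \<alpha> * D * a'"
    using step weight cross unfolding y2 h(3) by (simp add: algebra_simps)
  also have "\<dots> \<le> (1 - 2 * h) * a\<^sup>2 + (1 - 2 * h) * (r * q\<^sup>2) + h * y\<^sup>2 + 2 * \<alpha> * D * y"
  proof -
    have "3 / 4 * (r * q\<^sup>2) \<le> (1 - 2 * h) * (r * q\<^sup>2)"
      using h pos by (intro mult_right_mono) auto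
    moreover have "h * a'\<^sup>2 \<le> h * y\<^sup>2"
      using h ay pos by (intro mult_left_mono power_mono) auto
    moreover have "2 * \<alpha> * D * a' \<le> 2 * \<alpha> * D * y"
      using ay pos by (intro mult_left_mono) auto
    ultimately show ?thesis by simp
  qed
  also have "\<dots> = (1 - 2 * h) * \<Phi>\<^sup>2 + h * y\<^sup>2 + 2 * \<alpha> * D * y"
    by (simp add: \<Phi>2 algebra_simps)
  \<comment> \<open>Extracting \<open>1 - h\<close> lets it cancel once \<open>h * y\<^sup>2\<close>
    is moved to the left; this rests on \<open>1 - 2 * h \<le> (1 - h)\<^sup>2\<close> and
    \<open>1 / 2 \<le> 1 - h\<close>.\<close>
  also have "\<dots> \<le> (1 - h) * ((1 - h) * \<Phi>\<^sup>2) + h * y\<^sup>2 + (1 - h) * (4 * \<alpha> * D * y)"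
  proof -
    have "(1 - 2 * h) * \<Phi>\<^sup>2 \<le> (1 - h) * (1 - h) * \<Phi>\<^sup>2"
      by (rule mult_right_mono) (auto simp: algebra_simps)
    moreover have "1 / 2 * (4 * \<alpha> * D * y) \<le> (1 - h) * (4 * \<alpha> * D * y)"
      using h pos nn by (intro mult_right_mono) auto
    ultimately show ?thesis by (simp add: algebra_simps)
  qed
  finally have "(1 - h) * y\<^sup>2 \<le> (1 - h) * ((1 - h) * \<Phi>\<^sup>2 + 4 * \<alpha> * D * y)"
    by (simp add: algebra_simps)
  then have "y\<^sup>2 \<le> (1 - h) * \<Phi>\<^sup>2 + 4 * \<alpha> * D * y" using h by simp
  from le_of_square_le[OF this] have "y \<le> (1 - h / 2) * \<Phi> + 4 * \<alpha> * D"
    using h nn pos by simp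
  then show ?thesis by (simp add: y_def \<Phi>_def h_def)
qed

section \<open>Block structure of the refresh times\<close>

lemma refresh_time_bounds:
  assumes "K0 \<ge> 1" "k \<ge> 1"
  shows "1 \<le> refresh_time K0 k" "refresh_time K0 k \<le> k" "k < refresh_time K0 k + K0"
proof -
  have "(k - 1) div K0 * K0 + (k - 1) mod K0 = k - 1" "(k - 1) mod K0 < K0"
    using assms by auto
  then show "1 \<le> refresh_time K0 k" "refresh_time K0 k \<le> k" "k < refresh_time K0 k + K0"
    using assms(2) unfolding refresh_time_def by linarith+
qed

text \<open>Times start at 1, so the position of \<open>k\<close> in its block is
  \<open>(k - 1) mod K0\<close>, and \<open>k\<close> ends its block exactly when \<open>K0\<close>
  divides it.\<close>

lemma refresh_time_Suc:
  assumes "K0 \<ge> 1" "k \<ge> 1"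
  shows "k mod K0 = 0 \<Longrightarrow> refresh_time K0 (Suc k) = Suc k"
    and "k mod K0 \<noteq> 0 \<Longrightarrow> refresh_time K0 (Suc k) = refresh_time K0 k"
    and "k mod K0 \<noteq> 0 \<Longrightarrow> k mod K0 = Suc ((k - 1) mod K0)"
proof -
  obtain m where m: "k = Suc m" using assms(2) by (cases k) auto
  show "k mod K0 = 0 \<Longrightarrow> refresh_time K0 (Suc k) = Suc k"
    by (auto simp: refresh_time_def)
  show "k mod K0 \<noteq> 0 \<Longrightarrow> refresh_time K0 (Suc k) = refresh_time K0 k"
    by (simp add: refresh_time_def m div_Suc)
  show "k mod K0 \<noteq> 0 \<Longrightarrow> k mod K0 = Suc ((k - 1) mod K0)"
    by (simp add: m mod_Suc split: if_splits)
qed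

section \<open>Summation inequalities\<close>

text \<open>Truncated subtraction sends the first indices to 0, where \<open>b\<close> vanishes, so
  a delay merely drops nonnegative terms at the end.\<close>

lemma sum_delayed_le:
  fixes b :: "nat \<Rightarrow> real"
  assumes "\<And>k. 0 \<le> b k" and "b 0 = 0"
  shows "(\<Sum>k\<le>n. b (k - s)) \<le> (\<Sum>k\<le>n. b k)"
proof (induction n arbitrary: s)
  case (Suc n)
  show ?case
  proof (cases s)
    case (Suc r)
    have "(\<Sum>k\<le>Suc n. b (k - s)) = (\<Sum>k\<le>n. b (k - r))"
      by (subst sum.atMost_Suc_shift) (simp add: Suc assms(2))
    also have "\<dots> \<le> (\<Sum>k\<le>n. b k)" by (rule Suc.IH)
    also have "\<dots> \<le> (\<Sum>k\<le>Suc n. b k)" using assms(1) by simp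
    finally show ?thesis .
  qed simp
qed (simp add: assms)

text \<open>Cauchy-Schwarz against the constant 1; \<open>n\<close> may exceed the number of terms,
  as for a sum from 2 to \<open>K\<close>.\<close>

lemma sum_sqrt_le:
  assumes "\<And>t. t \<in> T \<Longrightarrow> 0 \<le> v t" and "card T \<le> n"
  shows "(\<Sum>t\<in>T. sqrt (v t)) \<le> sqrt (real n * (\<Sum>t\<in>T. v t))"
proof (rule real_le_rsqrt)
  have "(\<Sum>t\<in>T. sqrt (v t))\<^sup>2 \<le> (\<Sum>t\<in>T. (sqrt (v t))\<^sup>2) * real (card T)"
    by (rule sum_squared_le_sum_of_squares)
  also have "(\<Sum>t\<in>T. (sqrt (v t))\<^sup>2) = (\<Sum>t\<in>T. v t)"
    using assms(1) by (intro sum.cong) auto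
  also have "(\<Sum>t\<in>T. v t) * real (card T) \<le> (\<Sum>t\<in>T. v t) * real n"
    using assms by (intro mult_left_mono sum_nonneg) auto
  finally show "(\<Sum>t\<in>T. sqrt (v t))\<^sup>2 \<le> real n * (\<Sum>t\<in>T. v t)" by (simp add: mult.commute)
qed

text \<open>The extremal solution of a contraction inequality with perturbation, used as an explicit
  majorant.\<close>

primrec perturbed_contraction :: "real \<Rightarrow> real \<Rightarrow> (nat \<Rightarrow> real) \<Rightarrow> nat \<Rightarrow> real" where
  "perturbed_contraction \<theta> c b 0 = c"
| "perturbed_contraction \<theta> c b (Suc k) = \<theta> * perturbed_contraction \<theta> c b k + b k"

text \<open>Summing the recursion gives an exact identity with the extra nonnegative term
  \<open>\<theta>\<close> times the last value, which is dropped.\<close>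

lemma sum_perturbed_contraction:
  assumes "0 \<le> \<theta>" "0 \<le> c" "\<And>k. 0 \<le> b k"
  shows "(1 - \<theta>) * (\<Sum>k\<le>n. perturbed_contraction \<theta> c b k) \<le> c + (\<Sum>k<n. b k)"
proof -
  have "(1 - \<theta>) * (\<Sum>k\<le>n. perturbed_contraction \<theta> c b k) + \<theta> * perturbed_contraction \<theta> c b n
      = c + (\<Sum>k<n. b k)"
  proof (induction n)
    case (Suc n)
    let ?p = "perturbed_contraction \<theta> c b"
    have "(1 - \<theta>) * (\<Sum>k\<le>Suc n. ?p k) + \<theta> * ?p (Suc n)
        = (1 - \<theta>) * (\<Sum>k\<le>n. ?p k) + ?p (Suc n)"
      by (simp add: algebra_simps del: perturbed_contraction.simps)
    with Suc show ?case by simp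
  qed (simp add: algebra_simps)
  moreover have "0 \<le> perturbed_contraction \<theta> c b n"
    using assms by (induction n) auto
  ultimately show ?thesis using assms(1) by (smt (verit) mult_nonneg_nonneg)
qed

section \<open>The deterministic problem and the drift of its gradients\<close>

locale online_composite =
  fixes X :: "'a::euclidean_space set"
    and N K0 :: nat
    and f :: "nat \<Rightarrow> nat \<Rightarrow> 'a \<Rightarrow> real"
    and G :: "nat \<Rightarrow> nat \<Rightarrow> 'a \<Rightarrow> 'a"
    and g :: "nat \<Rightarrow> 'a \<Rightarrow> real"
    and xstar :: "nat \<Rightarrow> 'a"
    and L \<mu> :: real
  assumes convex_X: "convex X" and N: "N \<ge> 1" and K0: "K0 \<ge> 1"
    and L: "L > 0" and \<mu>: "\<mu> > 0"
    and gradient: "\<And>k i. k \<ge> 1 \<Longrightarrow> i \<in> {1..N} \<Longrightarrow> has_gradient_on (f k i) (G k i) X"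
    and convex_g: "\<And>k. k \<ge> 1 \<Longrightarrow> convex_on X (g k)"
    and minimizer: "\<And>k. k \<ge> 1 \<Longrightarrow>
      is_arg_min (\<lambda>y. average N (f k) y + g k y) (\<lambda>y. y \<in> X) (xstar k)"
    and lipschitz: "\<And>k i y z. k \<ge> 1 \<Longrightarrow> i \<in> {1..N} \<Longrightarrow> y \<in> X \<Longrightarrow> z \<in> X \<Longrightarrow>
      norm (G k i y - G k i z) \<le> L * norm (y - z)"
    and strongly_monotone: "\<And>k i y z. k \<ge> 1 \<Longrightarrow> i \<in> {1..N} \<Longrightarrow> y \<in> X \<Longrightarrow> z \<in> X \<Longrightarrow>
      (G k i y - G k i z) \<bullet> (y - z) \<ge> \<mu> * (norm (y - z))\<^sup>2"
    and variation_bounded: "\<And>k j. k \<ge> 2 \<Longrightarrow> j \<in> {1..N} \<Longrightarrow>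
      bdd_above ((\<lambda>y. (norm (G k j y - G (k - 1) j y))\<^sup>2) ` X)"
begin

lemma xstar_in: "k \<ge> 1 \<Longrightarrow> xstar k \<in> X"
  using minimizer by (auto simp: is_arg_min_def)

text \<open>The value 0 at times without a predecessor makes delays reaching before time 1
  harmless.\<close>

definition drift :: "nat \<Rightarrow> nat \<Rightarrow> real" where
  "drift j t = (if t < 2 then 0 else sqrt (SUP y\<in>X. (norm (G t j y - G (t - 1) j y))\<^sup>2))"

text \<open>A supremum of squares dominates its value at one point of \<open>X\<close>;
  \<open>xstar 1\<close> serves as that point.\<close>

lemma sup_nonneg:
  assumes "t \<ge> 2" "j \<in> {1..N}"
  shows "0 \<le> (SUP y\<in>X. (norm (G t j y - G (t - 1) j y))\<^sup>2)"
  using cSUP_upper[OF xstar_in[of 1] variation_bounded[OF assms]]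
  by (rule order_trans[OF zero_le_power2]) simp

lemma drift_nonneg: "j \<in> {1..N} \<Longrightarrow> 0 \<le> drift j t"
  using sup_nonneg by (simp add: drift_def)

lemma norm_step_le_drift:
  assumes "t \<ge> 2" "j \<in> {1..N}" "y \<in> X"
  shows "norm (G t j y - G (t - 1) j y) \<le> drift j t"
  using cSUP_upper[OF assms(3) variation_bounded[OF assms(1,2)]] assms(1)
  by (auto simp: drift_def intro: real_le_rsqrt)

text \<open>Fewer than \<open>K0\<close> steps separate a time from its refresh, so this window
  covers them. Summing over \<open>j\<close> gives one bound for all components, hence for their
  average.\<close>

definition recent_drift :: "nat \<Rightarrow> real" where
  "recent_drift k = (\<Sum>j=1..N. \<Sum>s<K0. drift j (k - s))"

lemma recent_drift_nonneg: "0 \<le> recent_drift k"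
  unfolding recent_drift_def by (intro sum_nonneg drift_nonneg) auto

lemma norm_delayed_le_drift:
  assumes "j \<in> {1..N}" "y \<in> X" "n < k"
  shows "norm (G (k - n) j y - G k j y) \<le> (\<Sum>s<n. drift j (k - s))"
  using assms(3)
proof (induction n)
  case (Suc n)
  have "norm (G (k - Suc n) j y - G k j y)
      \<le> norm (G (k - n) j y - G (k - Suc n) j y) + norm (G (k - n) j y - G k j y)"
    by (metis norm_minus_commute norm_triangle_sub norm_triangle_le_diff norm_diff_triangle_le order_refl)
  also have "norm (G (k - n) j y - G (k - Suc n) j y) \<le> drift j (k - n)"
    using norm_step_le_drift[of "k - n" j y] assms Suc.prems by simp
  finally show ?case using Suc by simp
qed simp

lemma average_delayed_le:
  assumes "k \<ge> 1" "y \<in> X"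
  shows "norm (average N (G (refresh_time K0 k)) y - average N (G k) y) \<le> recent_drift k"
proof (rule average_diff_norm_le[OF N])
  fix j assume j: "j \<in> {1..N}"
  define n where "n = k - refresh_time K0 k"
  have n: "n < k" "n < K0" "refresh_time K0 k = k - n"
    using refresh_time_bounds[OF K0 assms(1)] by (auto simp: n_def)
  have "norm (G (k - n) j y - G k j y) \<le> (\<Sum>s<n. drift j (k - s))"
    by (rule norm_delayed_le_drift) (use j assms n in auto)
  also have "\<dots> \<le> (\<Sum>s<K0. drift j (k - s))"
    using n drift_nonneg[OF j] by (intro sum_mono2) auto
  also have "\<dots> \<le> recent_drift k"
    unfolding recent_drift_def using j
    by (intro member_le_sum) (auto intro!: sum_nonneg drift_nonneg)
  finally show "norm (G (refresh_time K0 k) j y - G k j y) \<le> recent_drift k" by (simp add: n)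
qed

text \<open>After exchanging the sums, each of the \<open>K0\<close> delays costs at most the
  undelayed sum, to which Cauchy-Schwarz applies.\<close>

lemma sum_recent_drift_le:
  "(\<Sum>k=1..K. recent_drift k) \<le> real K0 * (\<Sum>j=1..N. sqrt (real K * gradient_variation X G j K))"
proof -
  have "(\<Sum>k=1..K. drift j (k - s)) \<le> sqrt (real K * gradient_variation X G j K)"
    if j: "j \<in> {1..N}" for j s
  proof -
    have "(\<Sum>k=1..K. drift j (k - s)) \<le> (\<Sum>k\<le>K. drift j (k - s))"
      using drift_nonneg[OF j] by (intro sum_mono2) auto
    also have "\<dots> \<le> (\<Sum>k\<le>K. drift j k)"
      by (rule sum_delayed_le) (auto simp: drift_nonneg[OF j], simp add: drift_def)
    also have "\<dots> = (\<Sum>k=2..K. drift j k)"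
      by (rule sum.mono_neutral_right) (auto simp: drift_def)
    also have "\<dots> = (\<Sum>k=2..K. sqrt (SUP y\<in>X. (norm (G k j y - G (k - 1) j y))\<^sup>2))"
      by (rule sum.cong) (auto simp: drift_def)
    also have "\<dots> \<le> sqrt (real K * gradient_variation X G j K)"
      unfolding gradient_variation_def using sup_nonneg j by (intro sum_sqrt_le) auto
    finally show ?thesis .
  qed
  then have "(\<Sum>j=1..N. \<Sum>s<K0. \<Sum>k=1..K. drift j (k - s))
      \<le> (\<Sum>j=1..N. \<Sum>s<K0. sqrt (real K * gradient_variation X G j K))"
    by (intro sum_mono) auto
  moreover have "(\<Sum>k=1..K. recent_drift k) = (\<Sum>j=1..N. \<Sum>s<K0. \<Sum>k=1..K. drift j (k - s))"
    unfolding recent_drift_def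
    by (subst sum.swap, rule sum.cong[OF refl], rule sum.swap)
  ultimately show ?thesis by (simp add: sum_distrib_left)
qed

section \<open>The potential and its majorant\<close>

text \<open>
  The decay by 4 per step absorbs \<open>(d + q)\<^sup>2 \<le> 2 * d\<^sup>2 + 2 * q\<^sup>2\<close> with half of the old weight
  to spare; at a refresh the displacement is 0, so the weight may jump back up.
\<close>

definition weight :: "nat \<Rightarrow> real" where
  "weight k = (1 / 4) ^ Suc ((k - 1) mod K0)"

text \<open>The centre \<open>s\<close> is a separate argument because a step is first measured
  against the old minimizer and only then recentred.\<close>

definition potential :: "(nat \<Rightarrow> 'a) \<Rightarrow> 'a \<Rightarrow> nat \<Rightarrow> real" where
  "potential x s k =
     sqrt ((norm (x k - s))\<^sup>2 + weight k * (norm (x k - x (refresh_time K0 k)))\<^sup>2)"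

lemma weight_bounds: "0 < weight k" "weight k \<le> 1 / 4" "(1 / 4) ^ K0 \<le> weight k"
proof -
  have "(k - 1) mod K0 < K0" using K0 by simp
  then show "(1 / 4) ^ K0 \<le> weight k"
    unfolding weight_def by (intro power_decreasing) auto
  show "0 < weight k" "weight k \<le> 1 / 4"
    using power_le_one[of "1/4::real" "(k - 1) mod K0"] by (auto simp: weight_def)
qed

text \<open>The potential is the Euclidean norm of a pair in the plane, of which only the first
  entry depends on the centre; the triangle inequality applies.\<close>

lemma potential_recenter: "potential x s k \<le> potential x s' k + norm (s - s')"
proof -
  let ?c = "sqrt (weight k) * norm (x k - x (refresh_time K0 k))"
  have eq: "potential x u k = sqrt ((norm (x k - u))\<^sup>2 + ?c\<^sup>2)" for u
    using weight_bounds(1)[of k] by (simp add: potential_def power_mult_distrib)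
  have "norm (x k - s) \<le> norm (x k - s') + norm (s - s')"
    by (metis norm_minus_commute norm_diff_triangle_le order_refl)
  then have "potential x s k \<le> sqrt ((norm (x k - s') + norm (s - s'))\<^sup>2 + (?c + 0)\<^sup>2)"
    unfolding eq by (simp add: power_mono)
  also have "\<dots> \<le> sqrt ((norm (x k - s'))\<^sup>2 + ?c\<^sup>2) + sqrt ((norm (s - s'))\<^sup>2 + 0\<^sup>2)"
    by (rule real_sqrt_sum_squares_triangle_ineq)
  finally show ?thesis by (simp add: eq)
qed

text \<open>The factor \<open>2 ^ K0\<close> is the inverse square root of
  \<open>(1 / 4) ^ K0\<close>, the lower bound for the weights.\<close>

lemma displacement_le_potential:
  "norm (x k - x (refresh_time K0 k)) \<le> 2 ^ K0 * potential x s k"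
proof -
  let ?q = "norm (x k - x (refresh_time K0 k))"
  have "((1 / 2) ^ K0 * ?q)\<^sup>2 = (1 / 4) ^ K0 * ?q\<^sup>2"
    by (simp add: power_mult_distrib power2_eq_square flip: power_mult_distrib)
  also have "\<dots> \<le> (norm (x k - s))\<^sup>2 + weight k * ?q\<^sup>2"
    using weight_bounds(3)[of k] by (intro add_increasing mult_right_mono) auto
  finally have "(1 / 2) ^ K0 * ?q \<le> potential x s k"
    unfolding potential_def by (rule real_le_rsqrt)
  then show ?thesis by (simp add: field_simps power_one_over)
qed

text \<open>Shifted by one: index \<open>k\<close> majorizes the potential at time
  \<open>Suc k\<close>. It depends on the starting point but not on the selected indices.\<close>

definition error_bound :: "real \<Rightarrow> 'a \<Rightarrow> nat \<Rightarrow> real" where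
  "error_bound \<alpha> x1 = perturbed_contraction (1 - \<alpha> * \<mu> / 4) (norm (x1 - xstar 1))
     (\<lambda>k. 4 * \<alpha> * recent_drift (Suc k) + norm (xstar (Suc (Suc k)) - xstar (Suc k)))"

section \<open>Estimates along one trajectory with a given index sequence\<close>

context
  fixes \<alpha> :: real and x1 :: 'a and i :: "nat \<Rightarrow> nat" and x :: "nat \<Rightarrow> 'a"
  assumes \<alpha>: "0 < \<alpha>" "32 * \<alpha> * L\<^sup>2 \<le> (1 / 4) ^ K0 * \<mu>" "4 * (\<alpha> * \<mu>) \<le> 1"
    and prox_exists: "\<And>k y. k \<ge> 1 \<Longrightarrow>
      \<exists>u. is_arg_min (prox_objective \<alpha> (g k) y) (\<lambda>u. u \<in> X) u"
    and run: "op_svrg X N K0 G g x1 \<alpha> i x"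
    and index: "\<And>k. k \<ge> 1 \<Longrightarrow> i k \<in> {1..N}"
    and x1: "x1 \<in> X"
begin

lemma iterate_Suc:
  "k \<ge> 1 \<Longrightarrow> x (Suc k) = prox X \<alpha> (g k) (x k - \<alpha> *\<^sub>R svrg_gradient N K0 G i x k)"
  using run by (simp add: op_svrg_def)

lemma iterate_in:
  assumes "k \<ge> 1"
  shows "x k \<in> X"
proof (cases "k = 1")
  case True
  then show ?thesis using run x1 by (simp add: op_svrg_def)
next
  case False
  with assms obtain m where m: "k = Suc m" "m \<ge> 1" by (cases k) auto
  show ?thesis
    using prox_arg_min[OF prox_exists[OF m(2)]] by (simp add: m iterate_Suc[OF m(2)] is_arg_min_def)
qed

text \<open>Inserting the current average gradient at the refresh point separates change in space,
  two Lipschitz terms, from change in time, the drift.\<close>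

lemma gradient_error_le:
  assumes k: "k \<ge> 1"
  shows "norm (gradient_error N K0 G i x k)
    \<le> 2 * L * norm (x k - x (refresh_time K0 k)) + recent_drift k"
proof -
  let ?\<tau> = "refresh_time K0 k"
  have \<tau>: "x k \<in> X" "x ?\<tau> \<in> X" using iterate_in refresh_time_bounds[OF K0 k] k by auto
  have decomposition: "gradient_error N K0 G i x k
      = (G k (i k) (x k) - G k (i k) (x ?\<tau>)) - (average N (G k) (x k) - average N (G k) (x ?\<tau>))
        + (average N (G ?\<tau>) (x ?\<tau>) - average N (G k) (x ?\<tau>))"
    by (simp add: gradient_error_def svrg_gradient_def Let_def)
  have "norm (gradient_error N K0 G i x k) \<le> norm (G k (i k) (x k) - G k (i k) (x ?\<tau>))
      + norm (average N (G k) (x k) - average N (G k) (x ?\<tau>))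
      + norm (average N (G ?\<tau>) (x ?\<tau>) - average N (G k) (x ?\<tau>))"
    unfolding decomposition by (intro norm_triangle_mono norm_triangle_ineq4 order_refl)
  moreover have "norm (G k (i k) (x k) - G k (i k) (x ?\<tau>)) \<le> L * norm (x k - x ?\<tau>)"
    by (rule lipschitz[OF k index[OF k] \<tau>])
  moreover have "norm (average N (G k) (x k) - average N (G k) (x ?\<tau>)) \<le> L * norm (x k - x ?\<tau>)"
    by (rule average_diff_norm_le[OF N], rule lipschitz[OF k _ \<tau>])
  moreover have "norm (average N (G ?\<tau>) (x ?\<tau>) - average N (G k) (x ?\<tau>)) \<le> recent_drift k"
    by (rule average_delayed_le[OF k \<tau>(2)])
  ultimately show ?thesis by linarith
qed

lemma iterate_step:
  assumes k: "k \<ge> 1"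
  shows "(norm (x (Suc k) - xstar k))\<^sup>2 + (norm (x (Suc k) - x k))\<^sup>2 / 2
    \<le> (1 - \<alpha> * \<mu>) * (norm (x k - xstar k))\<^sup>2
      + 2 * \<alpha> * (2 * L * norm (x k - x (refresh_time K0 k)) + recent_drift k)
        * norm (x (Suc k) - xstar k)"
proof -
  let ?e = "gradient_error N K0 G i x k"
  note in_X = iterate_in[OF k] iterate_in[of "Suc k"] xstar_in[OF k]
  have "(norm (x (Suc k) - xstar k))\<^sup>2 + (norm (x (Suc k) - x k))\<^sup>2 / 2
      \<le> (1 - \<alpha> * \<mu>) * (norm (x k - xstar k))\<^sup>2 + 2 * \<alpha> * norm ?e * norm (x (Suc k) - xstar k)"
  proof (rule inexact_prox_step)
    show "\<alpha> * (g k (x (Suc k)) - g k (xstar k))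
        \<le> (x (Suc k) - (x k - \<alpha> *\<^sub>R (average N (G k) (x k) + ?e))) \<bullet> (xstar k - x (Suc k))"
      using prox_inequality[OF convex_X convex_g[OF k] \<alpha>(1) prox_exists[OF k] iterate_Suc[OF k]
          in_X(3)]
      by (simp add: gradient_error_def)
    show "g k (xstar k) - g k (x (Suc k)) \<le> average N (G k) (xstar k) \<bullet> (x (Suc k) - xstar k)"
      using gradient[OF k] in_X
      by (intro composite_minimizer_inequality[OF convex_X convex_g[OF k] minimizer[OF k]]
          average_has_derivative) auto
    show "\<mu> * (norm (x k - xstar k))\<^sup>2
        \<le> (average N (G k) (x k) - average N (G k) (xstar k)) \<bullet> (x k - xstar k)"
      by (rule average_diff_inner_ge[OF N]) (use strongly_monotone[OF k] in_X in auto)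
    show "norm (average N (G k) (x k) - average N (G k) (xstar k)) \<le> L * norm (x k - xstar k)"
      by (rule average_diff_norm_le[OF N]) (use lipschitz[OF k] in_X in auto)
    have "0 \<le> \<alpha> * L\<^sup>2" using \<alpha> by simp
    moreover have "(1 / 4) ^ K0 * \<mu> \<le> 1 * \<mu>" using \<mu> by (intro mult_right_mono power_le_one) auto
    ultimately show "2 * \<alpha> * L\<^sup>2 \<le> \<mu>" using \<alpha>(2) by linarith
  qed (rule \<alpha>(1))
  also have "2 * \<alpha> * norm ?e * norm (x (Suc k) - xstar k)
      \<le> 2 * \<alpha> * (2 * L * norm (x k - x (refresh_time K0 k)) + recent_drift k)
        * norm (x (Suc k) - xstar k)"
    using gradient_error_le[OF k] \<alpha>(1) by (intro mult_right_mono mult_left_mono) auto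
  finally show ?thesis by simp
qed

lemma potential_step:
  assumes k: "k \<ge> 1"
  shows "potential x (xstar k) (Suc k)
    \<le> (1 - \<alpha> * \<mu> / 4) * potential x (xstar k) k + 4 * \<alpha> * recent_drift k"
  unfolding potential_def
proof (rule potential_contraction[OF iterate_step[OF k]])
  let ?d = "norm (x (Suc k) - x k)" and ?q = "norm (x k - x (refresh_time K0 k))"
    and ?q' = "norm (x (Suc k) - x (refresh_time K0 (Suc k)))"
  show "weight (Suc k) * ?q'\<^sup>2 \<le> ?d\<^sup>2 / 2 + weight k / 2 * ?q\<^sup>2"
  proof (cases "k mod K0 = 0")
    case True
    then show ?thesis
      using refresh_time_Suc(1)[OF K0 k] weight_bounds(1)[of k] by simp
  next
    case False
    note refresh = refresh_time_Suc(2,3)[OF K0 k False]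
    have "?q' \<le> ?d + ?q"
      using norm_triangle_ineq[of "x (Suc k) - x k" "x k - x (refresh_time K0 k)"]
      by (simp add: refresh)
    then have "?q'\<^sup>2 \<le> (?d + ?q)\<^sup>2" by (simp add: power_mono)
    also have "\<dots> \<le> 2 * ?d\<^sup>2 + 2 * ?q\<^sup>2"
      using zero_le_power2[of "?d - ?q"] by (simp add: power2_eq_square algebra_simps)
    \<comment> \<open>Inside a block the next weight is a quarter of
      \<open>weight k\<close>.\<close>
    finally have "weight (Suc k) * ?q'\<^sup>2 \<le> weight k / 4 * (2 * ?d\<^sup>2 + 2 * ?q\<^sup>2)"
      using weight_bounds(1)[of k] refresh(2) by (simp add: weight_def)
    also have "\<dots> = weight k * ?d\<^sup>2 / 2 + weight k / 2 * ?q\<^sup>2"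
      by (simp add: algebra_simps)
    also have "weight k * ?d\<^sup>2 \<le> 1 * ?d\<^sup>2"
      using weight_bounds(2)[of k] by (intro mult_right_mono) auto
    finally show ?thesis by simp
  qed
  \<comment> \<open>The step size is tied to the lower bound of the weights, so the contraction
    applies at every position in a block.\<close>
  have "(1 / 4) ^ K0 * \<mu> \<le> weight k * \<mu>"
    using weight_bounds(3)[of k] \<mu> by (intro mult_right_mono) auto
  then show "32 * \<alpha> * L\<^sup>2 \<le> weight k * \<mu>" using \<alpha>(2) by linarith
qed (simp_all add: \<alpha> \<mu> weight_bounds(1) less_imp_le recent_drift_nonneg)

text \<open>At time 1 the displacement is 0, which gives the initial value; each later time
  contracts around the old minimizer and then recentres.\<close>

lemma potential_le_error_bound: "potential x (xstar (Suc k)) (Suc k) \<le> error_bound \<alpha> x1 k"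
proof (induction k)
  case 0
  show ?case using run by (simp add: error_bound_def potential_def refresh_time_def op_svrg_def)
next
  case (Suc k)
  have "potential x (xstar (Suc (Suc k))) (Suc (Suc k))
      \<le> potential x (xstar (Suc k)) (Suc (Suc k)) + norm (xstar (Suc (Suc k)) - xstar (Suc k))"
    by (rule potential_recenter)
  also have "potential x (xstar (Suc k)) (Suc (Suc k))
      \<le> (1 - \<alpha> * \<mu> / 4) * potential x (xstar (Suc k)) (Suc k) + 4 * \<alpha> * recent_drift (Suc k)"
    by (rule potential_step) simp
  also have "(1 - \<alpha> * \<mu> / 4) * potential x (xstar (Suc k)) (Suc k)
      \<le> (1 - \<alpha> * \<mu> / 4) * error_bound \<alpha> x1 k"
    using Suc \<alpha>(3) by (intro mult_left_mono) auto
  finally show ?case by (simp add: error_bound_def)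
qed

lemma gradient_error_le_error_bound:
  assumes k: "k \<ge> 1"
  shows "norm (gradient_error N K0 G i x k)
    \<le> 2 * L * 2 ^ K0 * error_bound \<alpha> x1 (k - 1) + recent_drift k"
proof -
  have "norm (x k - x (refresh_time K0 k)) \<le> 2 ^ K0 * potential x (xstar k) k"
    by (rule displacement_le_potential)
  also have "\<dots> \<le> 2 ^ K0 * error_bound \<alpha> x1 (k - 1)"
    using potential_le_error_bound[of "k - 1"] k by simp
  finally have "2 * L * norm (x k - x (refresh_time K0 k))
      \<le> 2 * L * (2 ^ K0 * error_bound \<alpha> x1 (k - 1))"
    using L by (intro mult_left_mono) auto
  then show ?thesis using gradient_error_le[OF k] by simp
qed

end

section \<open>Summation of the error bound over time\<close>

lemma error_bound_nonneg:
  assumes "0 < \<alpha>" "\<alpha> * \<mu> \<le> 4"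
  shows "0 \<le> error_bound \<alpha> x1 k"
proof (induction k)
  case (Suc k)
  have "error_bound \<alpha> x1 (Suc k) = (1 - \<alpha> * \<mu> / 4) * error_bound \<alpha> x1 k
      + (4 * \<alpha> * recent_drift (Suc k) + norm (xstar (Suc (Suc k)) - xstar (Suc k)))"
    by (simp add: error_bound_def)
  moreover have "0 \<le> 4 * \<alpha> * recent_drift (Suc k)"
    using assms(1) recent_drift_nonneg by simp
  moreover have "0 \<le> (1 - \<alpha> * \<mu> / 4) * error_bound \<alpha> x1 k"
    using Suc assms(2) by simp
  ultimately show ?case by simp
qed (simp add: error_bound_def)

lemma sum_error_bound_le:
  assumes \<alpha>: "0 < \<alpha>" "\<alpha> * \<mu> \<le> 4"
  obtains C where "\<And>K. K \<ge> 1 \<Longrightarrow>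
    (\<Sum>k=1..K. 2 * L * 2 ^ K0 * error_bound \<alpha> x1 (k - 1) + recent_drift k)
      \<le> C * (1 + path_length xstar K + (\<Sum>j=1..N. sqrt (real K * gradient_variation X G j K)))"
proof -
  \<comment> \<open>The factor of \<open>error_bound\<close> in the gradient error, divided by the
    contraction gap \<open>\<alpha> * \<mu> / 4\<close>.\<close>
  define B where "B = 2 * L * 2 ^ K0 * (4 / (\<alpha> * \<mu>))"
  define c where "c = norm (x1 - xstar 1)"
  define C where "C = B * (c + 4 * \<alpha> * real K0 + 1) + real K0"
  have nonneg: "0 \<le> B" "0 \<le> c" using L \<mu> \<alpha> by (auto simp: B_def c_def)
  show ?thesis
  proof
    fix K :: nat
    assume K: "K \<ge> 1"
    then obtain n where n: "K = Suc n" by (cases K) auto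
    define S where "S = (\<Sum>j=1..N. sqrt (real K * gradient_variation X G j K))"
    define W where "W = path_length xstar K"
    define R where "R = (\<Sum>k=1..K. recent_drift k)"
    have R: "0 \<le> R" "R \<le> real K0 * S"
      using recent_drift_nonneg sum_recent_drift_le by (auto simp: R_def S_def intro: sum_nonneg)
    \<comment> \<open>Nonnegativity of \<open>S\<close> is read off from
      \<open>0 \<le> R \<le> real K0 * S\<close> and \<open>K0 \<ge> 1\<close>.\<close>
    then have S: "0 \<le> S" using K0 by (smt (verit) of_nat_0_less_iff mult_pos_neg not_one_le_zero gr0I)
    have W: "0 \<le> W" by (auto simp: W_def path_length_def intro: sum_nonneg)
    have shift: "(\<Sum>k=1..K. b k) = (\<Sum>k\<le>n. b (Suc k))" for b :: "nat \<Rightarrow> real"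
      by (simp add: n sum.atLeast1_atMost_eq flip: lessThan_Suc_atMost)
    have "(1 - (1 - \<alpha> * \<mu> / 4)) * (\<Sum>k\<le>n. error_bound \<alpha> x1 k)
        \<le> c + (\<Sum>k<n. 4 * \<alpha> * recent_drift (Suc k) + norm (xstar (Suc (Suc k)) - xstar (Suc k)))"
      unfolding c_def error_bound_def using \<alpha> recent_drift_nonneg
      by (intro sum_perturbed_contraction) auto
    also have "\<dots> = c + 4 * \<alpha> * (\<Sum>k<n. recent_drift (Suc k))
        + (\<Sum>k<n. norm (xstar (Suc (Suc k)) - xstar (Suc k)))"
      by (simp add: sum.distrib sum_distrib_left)
    \<comment> \<open>With \<open>K = Suc n\<close>, the shift by 2 turns the range below
      \<open>n\<close> into \<open>2..K\<close>.\<close>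
    also have "(\<Sum>k<n. norm (xstar (Suc (Suc k)) - xstar (Suc k))) = W"
      unfolding W_def path_length_def n
      by (rule sum.reindex_bij_witness[of _ "\<lambda>k. k - 2" "\<lambda>k. k + 2"]) auto
    also have "(\<Sum>k<n. recent_drift (Suc k)) \<le> R"
      unfolding R_def shift using recent_drift_nonneg by (intro sum_mono2) auto
    finally have "\<alpha> * \<mu> / 4 * (\<Sum>k\<le>n. error_bound \<alpha> x1 k) \<le> c + 4 * \<alpha> * R + W"
      using \<alpha>(1) by simp
    then have "B * (\<alpha> * \<mu> / 4 * (\<Sum>k\<le>n. error_bound \<alpha> x1 k)) \<le> B * (c + 4 * \<alpha> * R + W)"
      by (rule mult_left_mono) (rule nonneg)
    moreover have "B * (\<alpha> * \<mu> / 4 * (\<Sum>k\<le>n. error_bound \<alpha> x1 k))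
        = 2 * L * 2 ^ K0 * (\<Sum>k\<le>n. error_bound \<alpha> x1 k)"
      using \<alpha> \<mu> by (simp add: B_def)
    moreover have "(\<Sum>k=1..K. 2 * L * 2 ^ K0 * error_bound \<alpha> x1 (k - 1) + recent_drift k)
        = 2 * L * 2 ^ K0 * (\<Sum>k\<le>n. error_bound \<alpha> x1 k) + R"
      by (simp only: sum.distrib R_def sum_distrib_left diff_Suc_1
          shift[of "\<lambda>k. 2 * L * 2 ^ K0 * error_bound \<alpha> x1 (k - 1)"])
    ultimately have "(\<Sum>k=1..K. 2 * L * 2 ^ K0 * error_bound \<alpha> x1 (k - 1) + recent_drift k)
        \<le> B * (c + 4 * \<alpha> * R + W) + R"
      by linarith
    also have "\<dots> \<le> B * (c + 4 * \<alpha> * (real K0 * S) + W) + real K0 * S"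
      using R(2) nonneg \<alpha>(1) by (intro add_mono mult_left_mono) auto
    also have "\<dots> \<le> B * ((c + 4 * \<alpha> * real K0 + 1) * (1 + W + S)) + real K0 * (1 + W + S)"
    proof (intro add_mono mult_left_mono)
      \<comment> \<open>This expression is the difference of the two sides of the next
        inequality.\<close>
      have "0 \<le> c * (W + S) + 4 * \<alpha> * real K0 * (1 + W) + (1 + S)"
        using W S nonneg \<alpha>(1) by simp
      then show "c + 4 * \<alpha> * (real K0 * S) + W \<le> (c + 4 * \<alpha> * real K0 + 1) * (1 + W + S)"
        by (simp add: algebra_simps)
    qed (use W nonneg in auto)
    also have "\<dots> = C * (1 + W + S)" by (simp add: C_def algebra_simps)
    finally show "(\<Sum>k=1..K. 2 * L * 2 ^ K0 * error_bound \<alpha> x1 (k - 1) + recent_drift k)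
      \<le> C * (1 + path_length xstar K + (\<Sum>j=1..N. sqrt (real K * gradient_variation X G j K)))"
      by (simp only: W_def S_def)
  qed
qed

end

section \<open>Passage to the expectation\<close>

text \<open>The integral of a nonintegrable function is 0 by convention, so \<open>0 \<le> b\<close>
  covers that case and no measurability of the trajectory has to be shown.\<close>

lemma (in prob_space) integral_le_bound:
  fixes h :: "'a \<Rightarrow> real"
  assumes "\<And>\<omega>. \<omega> \<in> space M \<Longrightarrow> h \<omega> \<le> b" and "0 \<le> b"
  shows "(\<integral>\<omega>. h \<omega> \<partial>M) \<le> b"
proof (cases "integrable M h")
  case True
  then show ?thesis using assms(1) by (intro integral_le_const) auto
qed (simp add: not_integrable_integral_eq assms(2))

theorem lemma5:
  fixes X :: "'a::euclidean_space set"
    and N K0 :: nat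
    and f :: "nat \<Rightarrow> nat \<Rightarrow> 'a \<Rightarrow> real"
    and G :: "nat \<Rightarrow> nat \<Rightarrow> 'a \<Rightarrow> 'a"
    and g :: "nat \<Rightarrow> 'a \<Rightarrow> real"
    and xstar :: "nat \<Rightarrow> 'a"
    and x1 :: 'a
    and P :: "'w measure"
    and \<iota> :: "nat \<Rightarrow> 'w \<Rightarrow> nat"
    and x :: "real \<Rightarrow> 'w \<Rightarrow> nat \<Rightarrow> 'a"
    and L \<mu> M :: real
  assumes "convex X" and "N \<ge> 1" and "K0 \<ge> 1" and "x1 \<in> X"
    and "L > 0" and "\<mu> > 0" and "M > 0"
    and gradient: "\<And>k i. k \<ge> 1 \<Longrightarrow> i \<in> {1..N} \<Longrightarrow> has_gradient_on (f k i) (G k i) X"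
    and convex_g: "\<And>k. k \<ge> 1 \<Longrightarrow> convex_on X (g k)"
    and minimizer: "\<And>k. k \<ge> 1 \<Longrightarrow>
      is_arg_min (\<lambda>y. average N (f k) y + g k y) (\<lambda>y. y \<in> X) (xstar k)"
    and lipschitz: "\<And>k i y z. k \<ge> 1 \<Longrightarrow> i \<in> {1..N} \<Longrightarrow> y \<in> X \<Longrightarrow> z \<in> X \<Longrightarrow>
      norm (G k i y - G k i z) \<le> L * norm (y - z)"
    and strongly_monotone: "\<And>k i y z. k \<ge> 1 \<Longrightarrow> i \<in> {1..N} \<Longrightarrow> y \<in> X \<Longrightarrow> z \<in> X \<Longrightarrow>
      (G k i y - G k i z) \<bullet> (y - z) \<ge> \<mu> * (norm (y - z))\<^sup>2"
    and variation_bounded: "\<And>k j. k \<ge> 2 \<Longrightarrow> j \<in> {1..N} \<Longrightarrow>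
      bdd_above ((\<lambda>y. (norm (G k j y - G (k - 1) j y))\<^sup>2) ` X)"
    and "prob_space P"
    and selection: "uniform_selection P N \<iota> \<or> cyclic_selection P N \<iota>"
    and prox_exists: "\<And>\<alpha> k y. 0 < \<alpha> \<Longrightarrow> \<alpha> < 2 * \<mu> / L\<^sup>2 \<Longrightarrow> k \<ge> 1 \<Longrightarrow>
      \<exists>u. is_arg_min (prox_objective \<alpha> (g k) y) (\<lambda>u. u \<in> X) u"
    and run: "\<And>\<alpha> \<omega>. 0 < \<alpha> \<Longrightarrow> \<alpha> < 2 * \<mu> / L\<^sup>2 \<Longrightarrow> \<omega> \<in> space P \<Longrightarrow>
      op_svrg X N K0 G g x1 \<alpha> (\<lambda>k. \<iota> k \<omega>) (x \<alpha> \<omega>)"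
    and gradient_bound: "\<And>\<alpha>. 0 < \<alpha> \<Longrightarrow> \<alpha> < 2 * \<mu> / L\<^sup>2 \<Longrightarrow>
      AE \<omega> in P. \<forall>k\<ge>1. \<forall>i\<in>{1..N}. norm (G k i (x \<alpha> \<omega> k)) \<le> M"
    and ratio: "\<mu> / L > 0.89"
  shows "\<exists>\<alpha>. 0 < \<alpha> \<and> \<alpha> < 2 * \<mu> / L\<^sup>2 \<and>
    (\<exists>C. \<forall>K\<ge>1. cumulative_error P N K0 G \<iota> (x \<alpha>) K
       \<le> C * (1 + path_length xstar K
              + (\<Sum>j=1..N. sqrt (real K * gradient_variation X G j K))))"
proof -
  interpret prob_space P by fact
  interpret online_composite X N K0 f G g xstar L \<mu>
    by unfold_locales (fact | erule (3) lipschitz | erule (3) strongly_monotone)+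
  \<comment> \<open>The first bound serves the contraction at the smallest weight, the second gives
    \<open>4 * (\<alpha> * \<mu>) \<le> 1\<close>.\<close>
  define \<alpha> where "\<alpha> = min ((1 / 4) ^ K0 * \<mu> / (32 * L\<^sup>2)) (1 / (4 * \<mu>))"
  have pos: "0 < \<alpha>" using L \<mu> by (simp add: \<alpha>_def)
  have le: "\<alpha> \<le> (1 / 4) ^ K0 * \<mu> / (32 * L\<^sup>2)" "\<alpha> \<le> 1 / (4 * \<mu>)" by (simp_all add: \<alpha>_def)
  have small: "32 * \<alpha> * L\<^sup>2 \<le> (1 / 4) ^ K0 * \<mu>" "4 * (\<alpha> * \<mu>) \<le> 1"
    using le L \<mu> by (simp_all add: pos_le_divide_eq mult_ac)
  have less: "\<alpha> < 2 * \<mu> / L\<^sup>2"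
  proof -
    have "(1 / 4) ^ K0 * \<mu> \<le> 1 * \<mu>" using \<mu> by (intro mult_right_mono power_le_one) auto
    then have "\<alpha> * L\<^sup>2 < 2 * \<mu>" using small(1) \<mu> by linarith
    then show ?thesis using L by (simp add: pos_less_divide_eq)
  qed
  \<comment> \<open>Both selection rules supply admissible indices, so the trajectory estimates
    apply at every outcome.\<close>
  have index: "\<iota> k \<omega> \<in> {1..N}" if "k \<ge> 1" "\<omega> \<in> space P" for k \<omega>
    using selection that N by (auto simp: uniform_selection_def cyclic_selection_def Suc_le_eq)
  have pointwise: "(\<integral>\<omega>. norm (gradient_error N K0 G (\<lambda>t. \<iota> t \<omega>) (x \<alpha> \<omega>) k) \<partial>P)
      \<le> 2 * L * 2 ^ K0 * error_bound \<alpha> x1 (k - 1) + recent_drift k" if k: "k \<ge> 1" for k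
  proof (rule integral_le_bound)
    show "norm (gradient_error N K0 G (\<lambda>t. \<iota> t \<omega>) (x \<alpha> \<omega>) k)
        \<le> 2 * L * 2 ^ K0 * error_bound \<alpha> x1 (k - 1) + recent_drift k" if "\<omega> \<in> space P" for \<omega>
      using prox_exists[OF pos less] run[OF pos less that] index[OF _ that] \<open>x1 \<in> X\<close>
      by (intro gradient_error_le_error_bound[OF pos small _ _ _ _ k])
    show "0 \<le> 2 * L * 2 ^ K0 * error_bound \<alpha> x1 (k - 1) + recent_drift k"
      using error_bound_nonneg[OF pos] recent_drift_nonneg L small(2) by simp
  qed
  obtain C where C: "\<And>K. K \<ge> 1 \<Longrightarrow>
    (\<Sum>k=1..K. 2 * L * 2 ^ K0 * error_bound \<alpha> x1 (k - 1) + recent_drift k)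
      \<le> C * (1 + path_length xstar K + (\<Sum>j=1..N. sqrt (real K * gradient_variation X G j K)))"
  proof -
    have "\<alpha> * \<mu> \<le> 4" using small(2) by simp
    from sum_error_bound_le[OF pos this, of x1] show ?thesis using that by blast
  qed
  have "cumulative_error P N K0 G \<iota> (x \<alpha>) K
      \<le> C * (1 + path_length xstar K + (\<Sum>j=1..N. sqrt (real K * gradient_variation X G j K)))"
    if "K \<ge> 1" for K
  proof -
    have "cumulative_error P N K0 G \<iota> (x \<alpha>) K
        \<le> (\<Sum>k=1..K. 2 * L * 2 ^ K0 * error_bound \<alpha> x1 (k - 1) + recent_drift k)"
      unfolding cumulative_error_def by (intro sum_mono pointwise) auto
    also note C[OF that]
    finally show ?thesis .
  qed
  then show ?thesis using pos less by blast
qed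

end
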